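(* Let (P1) and (AP1) be the economic dispatch problem and its sample average approximation with $N_s$ samples, as defined in the context, with $\beta^t\le\alpha^t$ for all $t\in\mathcal{T}$. Let $\vartheta^*$ and $\mathcal{S}^*$ denote the optimal value and the optimal solution set of (P1), and let $\hat{\vartheta}_{N_s}$ and $\hat{\mathcal{S}}_{N_s}$ denote the optimal value and the optimal solution set of (AP1). Suppose that: A1) the optimal solution set $\mathcal{S}^*$ of (P1) is nonempty; A2) the law of large numbers holds pointwise, that is, for each $\mathbf{p}_R$, $\hat{G}(\mathbf{p}_R)\to G(\mathbf{p}_R)$ with probability $1$ as $N_s\to\infty$. Then $\hat{\vartheta}_{N_s}\to\vartheta^*$ and $\mathbb{D}(\hat{\mathcal{S}}_{N_s},\mathcal{S}^* )\to 0$ with probability $1$ as $N_s\to\infty$.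
   Context: Setting: $M$ conventional generators, $N$ dispatchable loads, $I$ wind farms, $\mathcal{M}=\{1,\ldots,M\}$, $\mathcal{N}=\{1,\ldots,N\}$, $\mathcal{T}=\{1,\ldots,T\}$. Decision variables: $\mathbf{p}_G=\{P_{G_m}^t\}_{m\in\mathcal{M},t\in\mathcal{T}}$, $\mathbf{p}_D=\{P_{D_n}^t\}_{n\in\mathcal{N},t\in\mathcal{T}}$, $\mathbf{p}_R=[P_R^1,\ldots,P_R^T]'$, all real. Functions: each generation cost $C_m^t$ is a real-valued continuous convex increasing function (typically piecewise linear or smooth quadratic) of $P_{G_m}^t$; each load utility $U_n^t$ is a real-valued concave increasing function, either piecewise linear or smooth quadratic (hence continuous), of $P_{D_n}^t$. These are functions on the admissible power ranges $[P_{G_m}^{\min},P_{G_m}^{\max}]$ and $[P_{D_n}^{\min},P_{D_n}^{\max}]$. Feasible set, given by the linear constraints (with all bounds given finite real constants and $P_{G_m}^0$ given initial outputs): - $P_{G_m}^{\min}\le P_{G_m}^t\le P_{G_m}^{\max}$ for all $m\in\mathcal{M}$, $t\in\mathcal{T}$; - $P_{G_m}^t-P_{G_m}^{t-1}\le R_m^{\mathrm{up}}$ and $P_{G_m}^{t-1}-P_{G_m}^t\le R_m^{\mathrm{down}}$ for all $m\in\mathcal{M}$, $t\in\mathcal{T}$; - $\sum_{m=1}^M(P_{G_m}^{\max}-P_{G_m}^t)\ge \mathsf{SR}^t$ for all $t\in\mathcal{T}$; - $P_{D_n}^{\min}\le P_{D_n}^t\le P_{D_n}^{\max}$ for all $n\in\mathcal{N}$,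 $t\in\mathcal{T}$; - $P_R^{\min}\le P_R^t\le P_R^{\max}$ for all $t\in\mathcal{T}$; - $\sum_{m=1}^M P_{G_m}^t+P_R^t=\sum_{n=1}^N P_{D_n}^t+L^t$ for all $t\in\mathcal{T}$. Problem (P1): over this feasible set, minimize $$\sum_{t=1}^T\Big(\sum_{m=1}^M C_m^t(P_{G_m}^t)-\sum_{n=1}^N U_n^t(P_{D_n}^t)\Big)+G(\mathbf{p}_R),$$ where $$G(\mathbf{p}_R):=\mathbb{E}_{\mathbf{v}}\Big[\sum_{t=1}^T\Big(\alpha^t\Big[P_R^t-\sum_{i=1}^I W_i^t(v_i^t)\Big]^{+}-\beta^t\Big[P_R^t-\sum_{i=1}^I W_i^t(v_i^t)\Big]^{-}\Big)\Big].$$ Here $[a]^+:=\max\{a,0\}$, $[a]^-:=-\min\{a,0\}$; $\alpha^t,\beta^t$ are known fixed purchase and selling prices; $W_i^t(v_i^t)$ is the (integrable) random wind power of farm $i$ in slot $t$, a function of the random wind speed $v_i^t$; $\mathbf{v}$ collects all $v_i^t$. Problem (AP1): the same problem over the same feasible set with $G$ replaced by $$\hat{G}(\mathbf{p}_R):=\frac{1}{N_s}\sum_{s=1}^{N_s}\sum_{t=1}^T\delta^t\Big|P_R^t-\sum_{i=1}^I W_i^t(s)\Big|+\sum_{t=1}^T\gamma^t\Big(P_R^t-\sum_{i=1}^I\bar{W}_i^t\Big),$$ where $\delta^t:=(\alpha^t-\beta^t)/2$, $\gamma^t:=(\alpha^t+\beta^t)/2$, $\{W_i^t(s)\}_{s=1}^{N_s}$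 are Monte Carlo samples of $W_i^t$, and $\bar{W}_i^t$ are real-valued sample average estimates of the wind power outputs (assumed available). Thus $\hat{G}$, $\hat{\vartheta}_{N_s}$, $\hat{\mathcal{S}}_{N_s}$ depend on the samples and on $N_s$. Deviation of a set $\mathcal{A}$ from a set $\mathcal{B}$: $\mathbb{D}(\mathcal{A},\mathcal{B}):=\sup_{\mathbf{x}\in\mathcal{A}}\inf_{\mathbf{y}\in\mathcal{B}}\|\mathbf{x}-\mathbf{y}\|$, with $\|\cdot\|$ the Euclidean norm. *)

theory Defs
  imports "HOL-Probability.Probability"
begin

text \<open>
  Generators, loads, wind farms and time slots are indexed by finite types
  \<open>'m\<close>, \<open>'n\<close>, \<open>'i\<close>, \<open>'t\<close>, so that \<open>M = CARD('m)\<close>, \<open>N = CARD('n)\<close>, \<open>I = CARD('i)\<close>, \<open>T = CARD('t)\<close>.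
  The type \<open>'t\<close> is moreover linearly ordered, which is what the ramping constraints need;
  it plays the role of \<open>{1,\<dots>,T}\<close>.
\<close>

record ('m, 'n, 't) dispatch_data =
  gen_min :: "'m \<Rightarrow> real"
  gen_max :: "'m \<Rightarrow> real"
  gen_init :: "'m \<Rightarrow> real"
  ramp_up :: "'m \<Rightarrow> real"
  ramp_down :: "'m \<Rightarrow> real"
  reserve :: "'t \<Rightarrow> real"
  load_min :: "'n \<Rightarrow> real"
  load_max :: "'n \<Rightarrow> real"
  wind_min :: real
  wind_max :: real
  base_load :: "'t \<Rightarrow> real"

text \<open>
  A decision is a triple \<open>(pG, pD, pR)\<close>. The library norm on this type (nested vectors and
  binary products) is the Euclidean norm of the vector of all coordinates.
\<close>

type_synonym ('m, 'n, 't) decision = "(real^'t^'m) \<times> (real^'t^'n) \<times> (real^'t)"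

text \<open>The output in the slot before \<open>t\<close>; before the first slot it is the initial output \<open>p0\<close>.\<close>

definition prev_output :: "real \<Rightarrow> real^'t::{finite,linorder} \<Rightarrow> 't \<Rightarrow> real" where
  "prev_output p0 p t = (if {s. s < t} = {} then p0 else p $ Max {s. s < t})"

definition feasible_set ::
  "('m::finite, 'n::finite, 't::{finite,linorder}) dispatch_data \<Rightarrow> ('m, 'n, 't) decision set" where
  "feasible_set E = {(pG, pD, pR).
     (\<forall>m t. gen_min E m \<le> pG $ m $ t \<and> pG $ m $ t \<le> gen_max E m) \<and>
     (\<forall>m t. pG $ m $ t - prev_output (gen_init E m) (pG $ m) t \<le> ramp_up E m) \<and>
     (\<forall>m t. prev_output (gen_init E m) (pG $ m) t - pG $ m $ t \<le> ramp_down E m) \<and>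
     (\<forall>t. (\<Sum>m\<in>UNIV. gen_max E m - pG $ m $ t) \<ge> reserve E t) \<and>
     (\<forall>n t. load_min E n \<le> pD $ n $ t \<and> pD $ n $ t \<le> load_max E n) \<and>
     (\<forall>t. wind_min E \<le> pR $ t \<and> pR $ t \<le> wind_max E) \<and>
     (\<forall>t. (\<Sum>m\<in>UNIV. pG $ m $ t) + pR $ t = (\<Sum>n\<in>UNIV. pD $ n $ t) + base_load E t)}"

definition pos_part :: "real \<Rightarrow> real" where "pos_part a = max a 0"

definition neg_part :: "real \<Rightarrow> real" where "neg_part a = - min a 0"

definition expected_transaction_cost ::
  "('t::finite \<Rightarrow> real) \<Rightarrow> ('t \<Rightarrow> real) \<Rightarrow> 'v measure \<Rightarrow>
   ('i::finite \<Rightarrow> 't \<Rightarrow> real \<Rightarrow> real) \<Rightarrow> ('i \<Rightarrow> 't \<Rightarrow> 'v \<Rightarrow> real) \<Rightarrow> real^'t \<Rightarrow> real" where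
  "expected_transaction_cost \<alpha> \<beta> V W v pR =
     (\<integral>x. (\<Sum>t\<in>UNIV.
         \<alpha> t * pos_part (pR $ t - (\<Sum>i\<in>UNIV. W i t (v i t x)))
       - \<beta> t * neg_part (pR $ t - (\<Sum>i\<in>UNIV. W i t (v i t x)))) \<partial>V)"

text \<open>
  Here \<open>Ws s i t\<close> is the value of the \<open>s\<close>-th sample, \<open>s = 1, 2, \<dots>\<close>, of the power of farm \<open>i\<close>
  in slot \<open>t\<close>, and \<open>Wbar i t\<close> is the available estimate of the mean power.
\<close>

definition saa_transaction_cost ::
  "('t::finite \<Rightarrow> real) \<Rightarrow> ('t \<Rightarrow> real) \<Rightarrow> nat \<Rightarrow>
   (nat \<Rightarrow> 'i::finite \<Rightarrow> 't \<Rightarrow> real) \<Rightarrow> ('i \<Rightarrow> 't \<Rightarrow> real) \<Rightarrow> real^'t \<Rightarrow> real" where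
  "saa_transaction_cost \<alpha> \<beta> Ns Ws Wbar pR =
     (1 / real Ns) * (\<Sum>s=1..Ns. \<Sum>t\<in>UNIV.
         ((\<alpha> t - \<beta> t) / 2) * \<bar>pR $ t - (\<Sum>i\<in>UNIV. Ws s i t)\<bar>)
     + (\<Sum>t\<in>UNIV. ((\<alpha> t + \<beta> t) / 2) * (pR $ t - (\<Sum>i\<in>UNIV. Wbar i t)))"

text \<open>The net cost, with \<open>g\<close> in the place of the transaction cost.\<close>

definition net_cost ::
  "('m::finite \<Rightarrow> 't::finite \<Rightarrow> real \<Rightarrow> real) \<Rightarrow> ('n::finite \<Rightarrow> 't \<Rightarrow> real \<Rightarrow> real) \<Rightarrow>
   (real^'t \<Rightarrow> real) \<Rightarrow> ('m, 'n, 't) decision \<Rightarrow> real" where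
  "net_cost C U g = (\<lambda>(pG, pD, pR).
     (\<Sum>t\<in>UNIV. (\<Sum>m\<in>UNIV. C m t (pG $ m $ t)) - (\<Sum>n\<in>UNIV. U n t (pD $ n $ t))) + g pR)"

text \<open>
  Optimal values and deviations are extended reals, so that suprema and infima need no
  side conditions.
\<close>

definition optimal_value :: "'a set \<Rightarrow> ('a \<Rightarrow> real) \<Rightarrow> ereal" where
  "optimal_value F f = (INF x\<in>F. ereal (f x))"

definition optimal_solutions :: "'a set \<Rightarrow> ('a \<Rightarrow> real) \<Rightarrow> 'a set" where
  "optimal_solutions F f = {x \<in> F. \<forall>y\<in>F. f x \<le> f y}"

definition deviation :: "'a::real_normed_vector set \<Rightarrow> 'a set \<Rightarrow> ereal" where
  "deviation A B = (SUP x\<in>A. INF y\<in>B. ereal (norm (x - y)))"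

text \<open>The pieces are closed intervals, so a piecewise linear function is continuous.\<close>

definition piecewise_linear_on :: "real \<Rightarrow> real \<Rightarrow> (real \<Rightarrow> real) \<Rightarrow> bool" where
  "piecewise_linear_on a b f \<longleftrightarrow>
     (\<exists>(K::nat) x. x 0 = a \<and> x K = b \<and>
        (\<forall>k<K. x k \<le> x (Suc k) \<and> (\<exists>c d. \<forall>y\<in>{x k..x (Suc k)}. f y = c * y + d)))"

definition quadratic_on :: "real \<Rightarrow> real \<Rightarrow> (real \<Rightarrow> real) \<Rightarrow> bool" where
  "quadratic_on a b f \<longleftrightarrow> (\<exists>c2 c1 c0. \<forall>y\<in>{a..b}. f y = c2 * y\<^sup>2 + c1 * y + c0)"

end

theory Submission imports Defs begin

text \<open>
  The sampled transaction costs share a Lipschitz constant, whatever the samples. By A2, so does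
  their limit \<open>G\<close>, and almost surely the convergence holds simultaneously on a countable dense
  set of points. Equicontinuity upgrades this to uniform convergence on compact sets. The feasible
  set is compact and the other costs are continuous on it, so minimum and minimizers are stable.
\<close>

section \<open>Stability of minimum and minimizers under uniform convergence on a compact
  set\<close>

lemma optimal_value_eq:
  assumes "x \<in> optimal_solutions F f"
  shows "optimal_value F f = ereal (f x)"
  unfolding optimal_value_def
proof (rule antisym)
  show "(INF x\<in>F. ereal (f x)) \<le> ereal (f x)"
    using assms by (intro INF_lower) (simp add: optimal_solutions_def)
  show "ereal (f x) \<le> (INF x\<in>F. ereal (f x))"
    using assms by (intro INF_greatest) (simp add: optimal_solutions_def)
qed

lemma optimal_solutions_nonempty:
  assumes "compact F" "F \<noteq> {}" "continuous_on F f"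
  shows "optimal_solutions F f \<noteq> {}"
  using continuous_attains_inf[OF assms] by (auto simp: optimal_solutions_def)

text \<open>Both minima are attained, so each minimizer can be tested in the other problem:
  \<open>g x \<le> g (y k) < f k (y k) + e\<close> and
  \<open>f k (y k) \<le> f k x < g x + e\<close>.\<close>

lemma optimal_value_tendsto:
  fixes f :: "nat \<Rightarrow> 'a::topological_space \<Rightarrow> real"
  assumes F: "compact F" "F \<noteq> {}"
    and cont: "\<And>k. continuous_on F (f k)"
    and lim: "uniform_limit F f g sequentially"
  shows "(\<lambda>k. optimal_value F (f k)) \<longlonglongrightarrow> optimal_value F g"
proof -
  have "continuous_on F g"
    using cont by (intro uniform_limit_theorem[OF _ lim]) auto
  with F obtain x where x: "x \<in> optimal_solutions F g"
    using optimal_solutions_nonempty by blast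
  have "\<exists>y. y \<in> optimal_solutions F (f k)" for k
    using optimal_solutions_nonempty[OF F cont] by blast
  then obtain y where y: "\<And>k. y k \<in> optimal_solutions F (f k)"
    by metis
  have "(\<lambda>k. f k (y k)) \<longlonglongrightarrow> g x"
  proof (rule tendstoI)
    fix e :: real assume "e > 0"
    then have "\<forall>\<^sub>F k in sequentially. \<forall>z\<in>F. dist (f k z) (g z) < e"
      using lim by (simp add: uniform_limit_iff)
    then show "\<forall>\<^sub>F k in sequentially. dist (f k (y k)) (g x) < e"
    proof eventually_elim
      case (elim k)
      have mem: "x \<in> F" "y k \<in> F" and opt: "g x \<le> g (y k)" "f k (y k) \<le> f k x"
        using x y[of k] by (auto simp: optimal_solutions_def)
      show ?case
        using elim[rule_format, OF mem(1)] elim[rule_format, OF mem(2)] opt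
        by (simp add: dist_real_def)
    qed
  qed
  then show ?thesis
    using optimal_value_eq[OF x] optimal_value_eq[OF y] by simp
qed

text \<open>The points of \<open>F\<close> at distance at least \<open>\<epsilon>\<close> from every
  minimizer form a compact set. If it is nonempty, \<open>g\<close> attains its minimum there at a
  point that is not optimal, and the excess of this minimum over the optimal value serves as
  \<open>\<eta>\<close>.\<close>

lemma optimality_gap:
  fixes g :: "'a::metric_space \<Rightarrow> real"
  assumes F: "compact F" and cont: "continuous_on F g" and x: "x \<in> optimal_solutions F g"
    and "\<epsilon> > 0"
  obtains \<eta> where "\<eta> > 0"
    "\<And>z. z \<in> F \<Longrightarrow> g z < g x + \<eta> \<Longrightarrow> \<exists>y\<in>optimal_solutions F g. dist y z < \<epsilon>"
proof -
  define K where "K = F \<inter> (\<Inter>y\<in>optimal_solutions F g. - ball y \<epsilon>)"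
  have K: "compact K"
    unfolding K_def using F by (intro compact_Int_closed closed_INT) auto
  have in_K: "z \<in> K \<longleftrightarrow> z \<in> F \<and> \<not> (\<exists>y\<in>optimal_solutions F g. dist y z < \<epsilon>)" for z
    by (auto simp: K_def)
  show thesis
  proof (cases "K = {}")
    \<comment> \<open>With no point far from the minimizers, any positive \<open>\<eta>\<close>
      works.\<close>
    case True
    then show thesis using in_K by (intro that[of 1]) auto
  next
    case False
    have "continuous_on K g"
      by (rule continuous_on_subset[OF cont]) (auto simp: K_def)
    with K False obtain w where w: "w \<in> K" "\<And>z. z \<in> K \<Longrightarrow> g w \<le> g z"
      using continuous_attains_inf[of K g] by blast
    have "w \<notin> optimal_solutions F g"
      using w(1) in_K[of w] \<open>\<epsilon> > 0\<close> by (metis dist_self)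
    then have "g x < g w"
      using x w(1) in_K[of w] by (force simp: optimal_solutions_def)
    then show thesis
      using w(2) in_K by (intro that[of "g w - g x"]) (auto, force)
  qed
qed

text \<open>A minimizer of a uniformly close function is nearly optimal for \<open>g\<close>, and
  \<open>optimality_gap\<close> places nearly optimal points close to the true minimizers.\<close>

lemma deviation_optimal_solutions_tendsto:
  fixes f :: "nat \<Rightarrow> 'a::real_normed_vector \<Rightarrow> real"
  assumes F: "compact F" "F \<noteq> {}"
    and cont: "\<And>k. continuous_on F (f k)"
    and lim: "uniform_limit F f g sequentially"
  shows "(\<lambda>k. deviation (optimal_solutions F (f k)) (optimal_solutions F g)) \<longlonglongrightarrow> 0"
proof (rule order_tendstoI)
  let ?S = "optimal_solutions F g" and ?A = "\<lambda>k. optimal_solutions F (f k)"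
  \<comment> \<open>The supremum over an empty set would be \<open>-\<infinity>\<close>, so nonnegativity needs an optimal solution.\<close>
  have "0 \<le> deviation (?A k) ?S" for k
  proof -
    obtain a where "a \<in> ?A k"
      using optimal_solutions_nonempty[OF F cont] by blast
    then show ?thesis
      unfolding deviation_def by (intro SUP_upper2[of a] INF_greatest) auto
  qed
  then show "\<forall>\<^sub>F k in sequentially. a < deviation (?A k) ?S" if "a < 0" for a
    using that less_le_trans by (blast intro: always_eventually)
  fix a :: ereal assume a: "0 < a"
  \<comment> \<open>Strictly below \<open>a\<close>, because a supremum of distances below
    \<open>\<epsilon>\<close> is only bounded by \<open>\<epsilon>\<close> itself.\<close>
  then obtain \<epsilon> where \<epsilon>: "0 < ereal \<epsilon>" "ereal \<epsilon> < a"
    using ereal_dense2[OF a] by blast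
  have contg: "continuous_on F g"
    using cont by (intro uniform_limit_theorem[OF _ lim]) auto
  with F obtain x where x: "x \<in> ?S"
    using optimal_solutions_nonempty by blast
  obtain \<eta> where \<eta>: "\<eta> > 0" "\<And>z. z \<in> F \<Longrightarrow> g z < g x + \<eta> \<Longrightarrow> \<exists>y\<in>?S. dist y z < \<epsilon>"
    using optimality_gap[OF F(1) contg x] \<epsilon>(1) ereal_less(2) by metis
  \<comment> \<open>The approximation error is paid twice, at \<open>z\<close> and at
    \<open>x\<close>, hence half of the gap.\<close>
  have "\<forall>\<^sub>F k in sequentially. \<forall>z\<in>F. dist (f k z) (g z) < \<eta> / 2"
    using uniform_limitD[OF lim, of "\<eta> / 2"] \<eta>(1) by simp
  then show "\<forall>\<^sub>F k in sequentially. deviation (?A k) ?S < a"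
  proof eventually_elim
    case (elim k)
    have "(INF y\<in>?S. ereal (norm (z - y))) \<le> ereal \<epsilon>" if z: "z \<in> ?A k" for z
    proof -
      have mem: "z \<in> F" "x \<in> F" and opt: "f k z \<le> f k x"
        using z x by (auto simp: optimal_solutions_def)
      have "g z < g x + \<eta>"
        using elim[rule_format, OF mem(1)] elim[rule_format, OF mem(2)] opt
        unfolding dist_real_def by linarith
      then obtain y where "y \<in> ?S" "dist y z < \<epsilon>"
        using \<eta>(2) mem(1) by blast
      then show ?thesis
        by (intro INF_lower2[of y]) (auto simp: dist_norm norm_minus_commute)
    qed
    then have "deviation (?A k) ?S \<le> ereal \<epsilon>"
      unfolding deviation_def by (rule SUP_least)
    also note \<epsilon>(2)
    finally show ?case .
  qed
qed

section \<open>Lipschitz bounds and uniform convergence of transaction costs\<close>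

text \<open>Finitely many small balls centred in the dense set \<open>D\<close> cover
  \<open>K\<close>. Convergence is simultaneous at the finitely many centres, and the common
  Lipschitz constant carries it to the rest of each ball.\<close>

lemma equi_lipschitz_uniform_limit:
  fixes f :: "nat \<Rightarrow> 'a::metric_space \<Rightarrow> 'b::metric_space"
  assumes lip: "\<And>k. L-lipschitz_on UNIV (f k)" "L-lipschitz_on UNIV g"
    and D: "\<And>X. open X \<Longrightarrow> X \<noteq> {} \<Longrightarrow> \<exists>d\<in>D. d \<in> X"
    and lim: "\<And>d. d \<in> D \<Longrightarrow> (\<lambda>k. f k d) \<longlonglongrightarrow> g d"
    and K: "compact K"
  shows "uniform_limit K f g sequentially"
proof (rule uniform_limitI)
  fix e :: real assume "e > 0"
  have "L \<ge> 0"
    using lip(2) by (rule lipschitz_on_nonneg)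
  \<comment> \<open>Moving to a centre and back costs at most \<open>e / 4\<close> each time, and
    the error at the centre is below \<open>e / 4\<close>. The summand \<open>1\<close> keeps the
    denominator positive when \<open>L = 0\<close>.\<close>
  define r where "r = e / (4 * (L + 1))"
  have r: "r > 0" "L * r \<le> e / 4"
    using \<open>e > 0\<close> \<open>L \<ge> 0\<close> by (auto simp: r_def field_simps)
  have "K \<subseteq> (\<Union>d\<in>D. ball d r)"
  proof
    fix x
    show "x \<in> (\<Union>d\<in>D. ball d r)"
      using D[of "ball x r"] r(1) by (auto simp: dist_commute)
  qed
  then obtain D' where D': "D' \<subseteq> D" "finite D'" "K \<subseteq> (\<Union>d\<in>D'. ball d r)"
    using compactE_image[OF K, of D "\<lambda>d. ball d r"] by auto
  have "\<forall>\<^sub>F k in sequentially. \<forall>d\<in>D'. dist (f k d) (g d) < e / 4"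
    using D'(1) lim \<open>e > 0\<close> by (intro eventually_ball_finite D'(2) ballI tendstoD) auto
  then show "\<forall>\<^sub>F k in sequentially. \<forall>x\<in>K. dist (f k x) (g x) < e"
  proof eventually_elim
    case (elim k)
    show ?case
    proof
      fix x assume "x \<in> K"
      then obtain d where d: "d \<in> D'" "dist d x < r"
        using D'(3) by auto
      have Lr: "L * dist d x \<le> e / 4"
        using d(2) r(2) mult_left_mono[of "dist d x" r L] \<open>L \<ge> 0\<close> by linarith
      have "dist (f k x) (g x) \<le> dist (f k d) (f k x) + dist (f k d) (g d) + dist (g d) (g x)"
        using dist_triangle[of "f k x" "g x" "f k d"] dist_triangle[of "f k d" "g x" "g d"]
        by (simp add: dist_commute)
      also have "\<dots> < e"
        using lipschitz_onD[OF lip(1), of d x k] lipschitz_onD[OF lip(2), of d x]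
          elim[rule_format, OF d(1)] Lr \<open>e > 0\<close> by simp
      finally show "dist (f k x) (g x) < e" .
    qed
  qed
qed

text \<open>Shifting by a sample and taking absolute values is 1-Lipschitz in each coordinate, and
  averaging over samples does not enlarge the constant. It depends on the prices alone, so it is
  common to all sample sizes and outcomes.\<close>

lemma saa_transaction_cost_lipschitz:
  fixes \<alpha> \<beta> :: "'t::finite \<Rightarrow> real"
  shows "(\<Sum>t\<in>UNIV. \<bar>(\<alpha> t - \<beta> t) / 2\<bar> + \<bar>(\<alpha> t + \<beta> t) / 2\<bar>)-lipschitz_on UNIV
           (saa_transaction_cost \<alpha> \<beta> k Ws Wbar)"
proof (rule lipschitz_onI)
  fix p q :: "real^'t"
  let ?d = "\<lambda>t. (\<alpha> t - \<beta> t) / 2" and ?g = "\<lambda>t. (\<alpha> t + \<beta> t) / 2"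
    and ?w = "\<lambda>s t. \<Sum>i\<in>UNIV. Ws s i t"
  let ?D = "\<Sum>t\<in>UNIV. \<bar>?d t\<bar> * dist p q" and ?H = "\<Sum>t\<in>UNIV. \<bar>?g t\<bar> * dist p q"
  have comp: "\<bar>p $ t - q $ t\<bar> \<le> dist p q" for t
    using dist_vec_nth_le[of p t q] by (simp add: dist_real_def)
  have "\<bar>(\<Sum>s=1..k. \<Sum>t\<in>UNIV. ?d t * \<bar>p $ t - ?w s t\<bar>) - (\<Sum>s=1..k. \<Sum>t\<in>UNIV. ?d t * \<bar>q $ t - ?w s t\<bar>)\<bar>
      = \<bar>\<Sum>s=1..k. \<Sum>t\<in>UNIV. ?d t * (\<bar>p $ t - ?w s t\<bar> - \<bar>q $ t - ?w s t\<bar>)\<bar>"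
    by (simp add: sum_subtractf[symmetric] right_diff_distrib)
  also have "\<dots> \<le> (\<Sum>s=1..k. ?D)"
  proof (intro order_trans[OF sum_abs] sum_mono)
    fix s t
    have "\<bar>\<bar>p $ t - ?w s t\<bar> - \<bar>q $ t - ?w s t\<bar>\<bar> \<le> dist p q"
      using comp[of t] by linarith
    then show "\<bar>?d t * (\<bar>p $ t - ?w s t\<bar> - \<bar>q $ t - ?w s t\<bar>)\<bar> \<le> \<bar>?d t\<bar> * dist p q"
      unfolding abs_mult by (rule mult_left_mono) simp
  qed
  finally have "\<bar>1 / real k * (\<Sum>s=1..k. \<Sum>t\<in>UNIV. ?d t * \<bar>p $ t - ?w s t\<bar>)
      - 1 / real k * (\<Sum>s=1..k. \<Sum>t\<in>UNIV. ?d t * \<bar>q $ t - ?w s t\<bar>)\<bar> \<le> 1 / real k * (real k * ?D)"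
    unfolding right_diff_distrib[symmetric] abs_mult by (intro mult_mono) auto
  \<comment> \<open>For \<open>k = 0\<close> the factor \<open>1 / real k\<close> is
    \<open>0\<close>, so the left side vanishes.\<close>
  also have "\<dots> \<le> ?D"
    by (cases "k = 0") (auto intro!: sum_nonneg)
  finally have 1: "\<bar>1 / real k * (\<Sum>s=1..k. \<Sum>t\<in>UNIV. ?d t * \<bar>p $ t - ?w s t\<bar>)
      - 1 / real k * (\<Sum>s=1..k. \<Sum>t\<in>UNIV. ?d t * \<bar>q $ t - ?w s t\<bar>)\<bar> \<le> ?D" .
  have "(\<Sum>t\<in>UNIV. ?g t * (p $ t - (\<Sum>i\<in>UNIV. Wbar i t))) - (\<Sum>t\<in>UNIV. ?g t * (q $ t - (\<Sum>i\<in>UNIV. Wbar i t)))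
      = (\<Sum>t\<in>UNIV. ?g t * (p $ t - q $ t))"
    unfolding sum_subtractf[symmetric] right_diff_distrib[symmetric] by simp
  also have "\<bar>\<dots>\<bar> \<le> ?H"
    using comp by (intro order_trans[OF sum_abs] sum_mono) (auto simp: abs_mult intro!: mult_left_mono)
  finally have 2: "\<bar>(\<Sum>t\<in>UNIV. ?g t * (p $ t - (\<Sum>i\<in>UNIV. Wbar i t)))
      - (\<Sum>t\<in>UNIV. ?g t * (q $ t - (\<Sum>i\<in>UNIV. Wbar i t)))\<bar> \<le> ?H" .
  have "(\<Sum>t\<in>UNIV. \<bar>?d t\<bar> + \<bar>?g t\<bar>) * dist p q = ?D + ?H"
    by (simp only: sum.distrib distrib_right sum_distrib_right)
  with 1 2 show "dist (saa_transaction_cost \<alpha> \<beta> k Ws Wbar p) (saa_transaction_cost \<alpha> \<beta> k Ws Wbar q)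
      \<le> (\<Sum>t\<in>UNIV. \<bar>?d t\<bar> + \<bar>?g t\<bar>) * dist p q"
    unfolding saa_transaction_cost_def dist_real_def by linarith
qed (simp add: sum_nonneg)

section \<open>Continuity of the costs and compactness of the feasible set\<close>

lemma piecewise_linear_on_imp_continuous_on:
  assumes "piecewise_linear_on a b f"
  shows "continuous_on {a..b} f"
proof -
  obtain K :: nat and x where x: "x 0 = a" "x K = b"
    and piece: "\<And>k. k < K \<Longrightarrow> x k \<le> x (Suc k) \<and> (\<exists>c d. \<forall>y\<in>{x k..x (Suc k)}. f y = c * y + d)"
    using assms unfolding piecewise_linear_on_def by blast
  \<comment> \<open>The pieces are glued from left to right. The bound \<open>a \<le> x k\<close> is
    carried along so that the two closed intervals meeting at \<open>x k\<close> unite to a single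
    one.\<close>
  have "k \<le> K \<Longrightarrow> a \<le> x k \<and> continuous_on {a..x k} f" for k
  proof (induction k)
    case 0
    then show ?case by (simp add: x(1))
  next
    case (Suc k)
    then have IH: "a \<le> x k" "continuous_on {a..x k} f" and le: "x k \<le> x (Suc k)"
      using piece[of k] by auto
    obtain c d where "\<forall>y\<in>{x k..x (Suc k)}. f y = c * y + d"
      using piece[of k] Suc.prems by auto
    then have "continuous_on {x k..x (Suc k)} f"
      by (subst continuous_on_cong[OF refl, of _ f "\<lambda>y. c * y + d"]) (auto intro!: continuous_intros)
    with IH(2) have "continuous_on ({a..x k} \<union> {x k..x (Suc k)}) f"
      by (intro continuous_on_closed_Un) auto
    then show ?case
      using IH(1) le by (simp add: ivl_disj_un_two_touch)
  qed
  from this[of K] show ?thesis by (simp add: x(2))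
qed

lemma quadratic_on_imp_continuous_on:
  assumes "quadratic_on a b f"
  shows "continuous_on {a..b} f"
proof -
  obtain c2 c1 c0 where "\<forall>y\<in>{a..b}. f y = c2 * y\<^sup>2 + c1 * y + c0"
    using assms unfolding quadratic_on_def by blast
  then show ?thesis
    by (subst continuous_on_cong[OF refl, of _ f "\<lambda>y. c2 * y\<^sup>2 + c1 * y + c0"])
      (auto intro!: continuous_intros)
qed

lemma compact_feasible_set:
  fixes E :: "('m::finite, 'n::finite, 't::{finite,linorder}) dispatch_data"
  shows "compact (feasible_set E)"
proof -
  \<comment> \<open>The case distinction in \<open>prev_output\<close> depends on the slot only, so
    for fixed \<open>t\<close> it is either a constant or one coordinate of the decision.\<close>
  have prev: "continuous_on A (\<lambda>x. prev_output c (h x) t)"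
    if "continuous_on A h" for A :: "('m, 'n, 't) decision set" and c h and t :: 't
    using that unfolding prev_output_def
    by (cases "{s. s < t} = {}") (simp_all only: simp_thms if_True if_False continuous_on_const continuous_on_component)
  have "closed (feasible_set E)"
    unfolding feasible_set_def case_prod_beta'
    by (intro closed_Collect_conj closed_Collect_all closed_Collect_le closed_Collect_eq
        continuous_intros prev)
  moreover have "feasible_set E \<subseteq>
      cbox (\<chi> m t. gen_min E m) (\<chi> m t. gen_max E m) \<times>
      cbox (\<chi> n t. load_min E n) (\<chi> n t. load_max E n) \<times>
      cbox (\<chi> t. wind_min E) (\<chi> t. wind_max E)"
    by (auto simp: feasible_set_def cbox_interval less_eq_vec_def)
  then have "bounded (feasible_set E)"
    by (rule bounded_subset[rotated]) (intro bounded_Times bounded_cbox)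
  ultimately show ?thesis
    by (simp add: compact_eq_bounded_closed)
qed

lemma continuous_on_net_cost:
  fixes E :: "('m::finite, 'n::finite, 't::{finite,linorder}) dispatch_data"
  assumes C: "\<And>m t. continuous_on {gen_min E m..gen_max E m} (C m t)"
    and U: "\<And>n t. continuous_on {load_min E n..load_max E n} (U n t)"
    and g: "continuous_on UNIV g"
  shows "continuous_on (feasible_set E) (net_cost C U g)"
  unfolding net_cost_def case_prod_beta'
  by (intro continuous_intros continuous_on_compose2[OF C] continuous_on_compose2[OF U]
      continuous_on_compose2[OF g]) (auto simp: feasible_set_def)

text \<open>Generation costs and utilities cancel in the difference of two net costs, so the error
  depends on the wind component alone.\<close>

lemma uniform_limit_net_cost:
  assumes "uniform_limit ((\<lambda>x. snd (snd x)) ` F) f g sequentially"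
  shows "uniform_limit F (\<lambda>k. net_cost C U (f k)) (net_cost C U g) sequentially"
  using assms by (simp add: uniform_limit_iff net_cost_def dist_real_def case_prod_beta')

section \<open>Almost sure convergence from pointwise almost sure limits\<close>

theorem proposition2:
  fixes E :: "('m::finite, 'n::finite, 't::{finite,linorder}) dispatch_data"
    and C :: "'m \<Rightarrow> 't \<Rightarrow> real \<Rightarrow> real"
    and U :: "'n \<Rightarrow> 't \<Rightarrow> real \<Rightarrow> real"
    and \<alpha> \<beta> :: "'t \<Rightarrow> real"
    and V :: "'v measure"
    and v :: "'i::finite \<Rightarrow> 't \<Rightarrow> 'v \<Rightarrow> real"
    and W :: "'i \<Rightarrow> 't \<Rightarrow> real \<Rightarrow> real"
    and \<Omega> :: "'w measure"
    and Ws Wbar :: "nat \<Rightarrow> 'i \<Rightarrow> 't \<Rightarrow> 'w \<Rightarrow> real"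
  defines "G \<equiv> expected_transaction_cost \<alpha> \<beta> V W v"
    and "Ghat \<equiv> \<lambda>Ns \<omega>. saa_transaction_cost \<alpha> \<beta> Ns (\<lambda>s i t. Ws s i t \<omega>) (\<lambda>i t. Wbar Ns i t \<omega>)"
  defines "val \<equiv> optimal_value (feasible_set E) (net_cost C U G)"
    and "S \<equiv> optimal_solutions (feasible_set E) (net_cost C U G)"
    and "valhat \<equiv> \<lambda>Ns \<omega>. optimal_value (feasible_set E) (net_cost C U (Ghat Ns \<omega>))"
    and "Shat \<equiv> \<lambda>Ns \<omega>. optimal_solutions (feasible_set E) (net_cost C U (Ghat Ns \<omega>))"
  assumes C_cont: "\<And>m t. continuous_on {gen_min E m..gen_max E m} (C m t)"
    and C_convex: "\<And>m t. convex_on {gen_min E m..gen_max E m} (C m t)"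
    and C_mono: "\<And>m t. mono_on {gen_min E m..gen_max E m} (C m t)"
    and U_concave: "\<And>n t. concave_on {load_min E n..load_max E n} (U n t)"
    and U_mono: "\<And>n t. mono_on {load_min E n..load_max E n} (U n t)"
    and U_form: "\<And>n t. piecewise_linear_on (load_min E n) (load_max E n) (U n t)
                      \<or> quadratic_on (load_min E n) (load_max E n) (U n t)"
    and prices: "\<And>t. \<beta> t \<le> \<alpha> t"
    and V: "prob_space V"
    and speed: "\<And>i t. v i t \<in> borel_measurable V"
    and power: "\<And>i t. integrable V (\<lambda>x. W i t (v i t x))"
    and \<Omega>: "prob_space \<Omega>"
    and samples_meas: "\<And>s i t. s \<ge> 1 \<Longrightarrow> Ws s i t \<in> borel_measurable \<Omega>"
    and samples_distr: "\<And>s i t. s \<ge> 1 \<Longrightarrow>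
          distr \<Omega> borel (Ws s i t) = distr V borel (\<lambda>x. W i t (v i t x))"
    and estimates: "\<And>Ns i t. Wbar Ns i t \<in> borel_measurable \<Omega>"
    and A1: "S \<noteq> {}"
    and A2: "\<And>pR. AE \<omega> in \<Omega>. (\<lambda>Ns. Ghat Ns \<omega> pR) \<longlonglongrightarrow> G pR"
  shows "AE \<omega> in \<Omega>. (\<lambda>Ns. valhat Ns \<omega>) \<longlonglongrightarrow> val \<and>
                     (\<lambda>Ns. deviation (Shat Ns \<omega>) S) \<longlonglongrightarrow> 0"
proof -
  define L where "L = (\<Sum>t\<in>UNIV. \<bar>(\<alpha> t - \<beta> t) / 2\<bar> + \<bar>(\<alpha> t + \<beta> t) / 2\<bar>)"
  have lip: "L-lipschitz_on UNIV (Ghat k \<omega>)" for k \<omega>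
    unfolding L_def Ghat_def by (rule saa_transaction_cost_lipschitz)
  \<comment> \<open>The bound is inherited from the approximations instead of being read off the
    integral: for fixed \<open>p\<close> and \<open>q\<close> it passes to the limit at almost every
    outcome, and since it does not mention the outcome, it holds outright in a probability
    space.\<close>
  have lipG: "L-lipschitz_on UNIV G"
  proof (rule lipschitz_onI)
    fix p q
    have "AE \<omega> in \<Omega>. dist (G p) (G q) \<le> L * dist p q"
      using A2[of p] A2[of q]
    proof eventually_elim
      case (elim \<omega>)
      show ?case
        using lipschitz_onD[OF lip] by (intro LIMSEQ_le_const2[OF tendsto_dist[OF elim]]) auto
    qed
    then show "dist (G p) (G q) \<le> L * dist p q"
      using prob_space.AE_const[OF \<Omega>] by blast
  qed (rule lipschitz_on_nonneg[OF lip])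
  obtain D :: "(real, 't) vec set" where D: "countable D"
    "\<And>X. open X \<Longrightarrow> X \<noteq> {} \<Longrightarrow> \<exists>d\<in>D. d \<in> X"
    using countable_dense_setE by blast
  have contU: "continuous_on {load_min E n..load_max E n} (U n t)" for n t
    using U_form piecewise_linear_on_imp_continuous_on quadratic_on_imp_continuous_on by blast
  have nonempty: "feasible_set E \<noteq> {}"
    using A1 by (auto simp: S_def optimal_solutions_def)
  \<comment> \<open>The null set in \<open>A2\<close> may vary with the point; countability of
    \<open>D\<close> leaves one null set for all its points.\<close>
  have "AE \<omega> in \<Omega>. \<forall>d\<in>D. (\<lambda>k. Ghat k \<omega> d) \<longlonglongrightarrow> G d"
    using A2 D(1) by (simp add: AE_ball_countable)
  then show ?thesis
  proof eventually_elim
    case (elim \<omega>)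
    \<comment> \<open>From here the outcome is fixed and the argument is deterministic; uniform
      convergence is needed only on the projection to wind schedules.\<close>
    have "compact ((\<lambda>x. snd (snd x)) ` feasible_set E)"
      by (intro compact_continuous_image compact_feasible_set continuous_intros)
    then have "uniform_limit ((\<lambda>x. snd (snd x)) ` feasible_set E) (\<lambda>k. Ghat k \<omega>) G sequentially"
      using elim by (intro equi_lipschitz_uniform_limit[OF lip lipG D(2)]) auto
    then have lim: "uniform_limit (feasible_set E) (\<lambda>k. net_cost C U (Ghat k \<omega>))
        (net_cost C U G) sequentially"
      by (rule uniform_limit_net_cost)
    have cont: "continuous_on (feasible_set E) (net_cost C U (Ghat k \<omega>))" for k
      by (intro continuous_on_net_cost C_cont contU lipschitz_on_continuous_on[OF lip])
    show ?case
      unfolding val_def S_def valhat_def Shat_def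
      using optimal_value_tendsto[OF compact_feasible_set nonempty cont lim]
        deviation_optimal_solutions_tendsto[OF compact_feasible_set nonempty cont lim] by blast
  qed
qed

end
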